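(* In the setting described in the context, consider exact data $y=(y_0,\dots,y_{N-1})$ (so $\delta_i=0$ and $\omega_k=1$ for all $k$), and let $(x_k)_{k\in\mathbb N}$ be the resulting iteration started at $x_0$. Then $(x_k)$ converges, as $k\to\infty$, to a solution of the system $F_i(x)=y_i$, $i=0,\dots,N-1$. Moreover, if $$\ker(F'(x^\dagger))\subseteq \ker(F'(x))\qquad\text{for all } x\in B_\rho(x_0),$$ where $F'(x)=(F_0'(x),\dots,F_{N-1}'(x)):X\to Y^N$, then $x_k\to x^\dagger$.
   Context: Setting. $X,Y$ are Hilbert spaces, $N\ge 1$, $F_i:D_i\subset X\to Y$ for $i=0,\dots,N-1$, $F=(F_0,\dots,F_{N-1}):\bigcap_i D_i\to Y^N$, and $y=(y_0,\dots,y_{N-1})\in Y^N$ are the exact data. $B_r(x)$ denotes the open ball of radius $r$ centered at $x$. $[k]:=k \bmod N\in\{0,\dots,N-1\}$. Standing assumptions. There are $x_0\in X$, $M>0$, $\rho>0$ with $B_\rho(x_0)\subset\bigcap_i D_i$ such that every $F_i$ is continuously Fréchet differentiable and $\|F_i'(x)\|\le M$ for $x\in B_\rho(x_0)$. There is $\eta<1/2$ such that $\|F_i(x)-F_i(\bar x)-F_i'(x)(x-\bar x)\|\le \eta\|F_i(x)-F_i(\bar x)\|$ for all $x,\bar x\in B_\rho(x_0)$ and all $i$. There is $x^*\in B_{\rho/2}(x_0)$ with $F(x^* )=y$. The function $\Phi:(0,\infty)\to(0,\infty)$ is continuous, monotonically increasing, bounded by a constant $\alpha_{\max}$, and satisfies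 $\Phi(s)\le s$ for all $s$. Put $\alpha_{\min}:=\Phi(1/M^2)$. Iteration for exact data (Steepest-Descent-Kaczmarz method). Starting at $x_0$, $$x_{k+1}=x_k-\alpha_k s_k,\qquad s_k=F_{[k]}'(x_k)^*(F_{[k]}(x_k)-y_{[k]}),\qquad \alpha_k=\Phi\big(\|s_k\|^2/\|F_{[k]}'(x_k)s_k\|^2\big),$$ with the convention $\alpha_k:=\alpha_{\min}$ if $s_k=0$ (in which case $x_{k+1}=x_k$). $x^\dagger$ denotes the $x_0$-minimal norm solution in $B_{\rho/2}(x_0)$, i.e. the (existing and unique) $x^\dagger\in B_{\rho/2}(x_0)$ with $F(x^\dagger)=y$ and $\|x^\dagger-x_0\|=\inf\{\|x-x_0\|: x\in B_{\rho/2}(x_0),\ F(x)=y\}$. *)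

theory Defs
  imports "HOL-Analysis.Analysis"
begin

text \<open>
  Hilbert spaces are types of sort {real_inner, banach}. A complex Hilbert space is covered
  through its underlying real space with inner product Re <x, y>; norms and adjoints of
  complex-linear operators are unchanged by this. Elements of \<open>Y\<^sup>N\<close> are functions
  on nat of which only the values at indices below N are used. The operators \<open>F i\<close>
  are total functions, with \<open>D i\<close> the domain on which their values are meaningful, and
  \<open>F' i x\<close> is the Frechet derivative of \<open>F i\<close> at x.
\<close>

definition sd_direction ::
  "('a::{real_inner,banach} \<Rightarrow> 'b::{real_inner,banach}) \<Rightarrow> ('a \<Rightarrow> 'a \<Rightarrow>\<^sub>L 'b) \<Rightarrow> 'b \<Rightarrow> 'a \<Rightarrow> 'a"
  where "sd_direction f f' v x = adjoint (blinfun_apply (f' x)) (f x - v)"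

text \<open>
  For \<open>s \<noteq> 0\<close> in the range of the adjoint of A, \<open>A s\<close> is nonzero, so
  the quotient below is then a genuine one.
\<close>

definition sd_stepsize ::
  "(real \<Rightarrow> real) \<Rightarrow> real \<Rightarrow> ('a::{real_inner,banach} \<Rightarrow>\<^sub>L 'b::{real_inner,banach}) \<Rightarrow> 'a \<Rightarrow> real"
  where "sd_stepsize \<Phi> \<alpha>min A s =
    (if s = 0 then \<alpha>min else \<Phi> ((norm s)\<^sup>2 / (norm (blinfun_apply A s))\<^sup>2))"

primrec sd_kaczmarz ::
  "nat \<Rightarrow> (nat \<Rightarrow> 'a::{real_inner,banach} \<Rightarrow> 'b::{real_inner,banach}) \<Rightarrow> (nat \<Rightarrow> 'a \<Rightarrow> 'a \<Rightarrow>\<^sub>L 'b)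
    \<Rightarrow> (nat \<Rightarrow> 'b) \<Rightarrow> (real \<Rightarrow> real) \<Rightarrow> real \<Rightarrow> 'a \<Rightarrow> nat \<Rightarrow> 'a"
  where
    "sd_kaczmarz N F F' y \<Phi> \<alpha>min x0 0 = x0"
  | "sd_kaczmarz N F F' y \<Phi> \<alpha>min x0 (Suc k) =
      (let x = sd_kaczmarz N F F' y \<Phi> \<alpha>min x0 k;
           s = sd_direction (F (k mod N)) (F' (k mod N)) (y (k mod N)) x
       in x - sd_stepsize \<Phi> \<alpha>min (F' (k mod N) x) s *\<^sub>R s)"

definition solutions ::
  "nat \<Rightarrow> (nat \<Rightarrow> 'a set) \<Rightarrow> (nat \<Rightarrow> 'a \<Rightarrow> 'b) \<Rightarrow> (nat \<Rightarrow> 'b) \<Rightarrow> 'a set"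
  where "solutions N D F y = {x \<in> (\<Inter>i<N. D i). \<forall>i<N. F i x = y i}"

definition is_min_norm_solution ::
  "nat \<Rightarrow> (nat \<Rightarrow> 'a::{real_inner,banach} set) \<Rightarrow> (nat \<Rightarrow> 'a \<Rightarrow> 'b) \<Rightarrow> (nat \<Rightarrow> 'b)
    \<Rightarrow> 'a \<Rightarrow> real \<Rightarrow> 'a \<Rightarrow> bool"
  where "is_min_norm_solution N D F y x0 r z \<longleftrightarrow>
    z \<in> ball x0 r \<inter> solutions N D F y \<and>
    norm (z - x0) = (INF x \<in> ball x0 r \<inter> solutions N D F y. norm (x - x0))"

text \<open>
  The kernel of the joint derivative \<open>h \<mapsto> (F' 0 x h, \<dots>, F' (N - 1) x h)\<close> from X
  to \<open>Y\<^sup>N\<close>.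
\<close>

definition joint_kernel ::
  "nat \<Rightarrow> (nat \<Rightarrow> 'a::{real_inner,banach} \<Rightarrow> 'a \<Rightarrow>\<^sub>L 'b::{real_inner,banach}) \<Rightarrow> 'a \<Rightarrow> 'a set"
  where "joint_kernel N F' x = {h. \<forall>i<N. blinfun_apply (F' i x) h = 0}"

end

theory Submission
  imports Defs
begin

text \<open>
  The tangential cone condition with \<open>\<eta> < 1/2\<close> makes the iteration Fejer monotone: a step along
  \<open>s = A\<^sup>* r\<close>, where \<open>r\<close> is the current residual and \<open>A\<close> the derivative, does not increase the distance to
  any solution in the ball, and the squared distance drops by at least
  \<open>\<alpha>min (1 - 2 \<eta>) \<parallel>r\<parallel>\<^sup>2\<close> (\<open>step_descent\<close>). Two facts about the step size \<open>\<alpha>\<close> enter, both from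
  \<open>step_bounds\<close>: \<open>\<alpha> \<parallel>s\<parallel>\<^sup>2 \<le> \<parallel>r\<parallel>\<^sup>2\<close>, because \<open>\<Phi>\<close> lies below the identity, and \<open>\<alpha> \<ge> \<alpha>min\<close>,
  because \<open>\<Phi>\<close> is increasing. Hence the iterates stay near \<open>xstar\<close> and the residuals are square
  summable.

  Fejer monotonicity alone does not give strong convergence, which comes from an estimate
  on whole cycles of \<open>N\<close> steps. Let \<open>z m\<close> be the iterate at the start of cycle \<open>m\<close> and \<open>c m\<close> the
  sum of the residual norms in that cycle. The increment \<open>z (m + 1) - z m\<close> is a combination of vectors
  \<open>A\<^sup>* r\<close>, so its inner product with \<open>z l - xstar\<close> is controlled by residual norms alone, namely by
  a multiple of \<open>c m (c m + c l)\<close> (\<open>cycle_cross\<close>). Summing from \<open>j\<close> to \<open>k\<close>, with \<open>l\<close> the index in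
  between at which \<open>c\<close> is least, replaces this product by \<open>2 (c m)\<^sup>2\<close>, which telescopes
  (\<open>Fejer_imp_Cauchy\<close>). So \<open>z\<close> is Cauchy. Its limit is a solution because \<open>c\<close> tends to zero, and Fejer
  monotonicity with respect to this limit extends the convergence from \<open>z\<close> to all iterates.

  Under the kernel condition all directions \<open>A\<^sup>* r\<close> are orthogonal to the kernel of the joint
  derivative at \<open>xdag\<close>, and the cone condition puts the difference of two solutions into this
  kernel. Pythagoras then shows that the limit is no farther from \<open>x0\<close> than \<open>xdag\<close>, hence, by minimality, equal to
  it (\<open>limit_eq_min_norm_solution\<close>).

  The constant \<open>adjoint\<close> is defined by a choice of an operator that satisfies the adjoint identity.
  The existence of such an operator in infinite dimensions rests on the Riesz representation theorem.
\<close>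

section \<open>Adjoints in Hilbert spaces\<close>

lemma Cauchy_if_norm_diff_sq_le:
  fixes z :: "nat \<Rightarrow> 'a::real_normed_vector" and b :: "nat \<Rightarrow> real"
  assumes le: "\<And>j k. j \<le> k \<Longrightarrow> (norm (z j - z k))\<^sup>2 \<le> b j"
    and b: "b \<longlonglongrightarrow> 0"
  shows "Cauchy z"
proof (rule CauchyI')
  fix e :: real
  assume e: "0 < e"
  then have "\<forall>\<^sub>F j in sequentially. b j < e\<^sup>2"
    by (intro order_tendstoD(2)[OF b]) simp
  then obtain m where m: "\<And>j. j \<ge> m \<Longrightarrow> b j < e\<^sup>2"
    unfolding eventually_sequentially by blast
  have "norm (z j - z k) < e" if "j \<ge> m" "k > j" for j k
    using le[of j k] m[of j] that e by (intro power_less_imp_less_base[of _ 2 e]) auto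
  then show "\<exists>m. \<forall>j\<ge>m. \<forall>k>j. dist (z j) (z k) < e"
    by (auto simp: dist_norm)
qed

text \<open>
  The representing vector is the minimiser of \<open>x \<mapsto> \<parallel>x\<parallel>\<^sup>2 / 2 - \<phi> x\<close>: the parallelogram law makes
  minimising sequences Cauchy, and stationarity at the minimum is the representation.
\<close>
lemma riesz_representation:
  fixes \<phi> :: "'a::{real_inner,banach} \<Rightarrow> real"
  assumes "bounded_linear \<phi>"
  obtains u where "\<And>h. \<phi> h = h \<bullet> u"
proof -
  interpret \<phi>: bounded_linear \<phi> by fact
  define J where "J = (\<lambda>x. (x \<bullet> x) / 2 - \<phi> x)"
  obtain B where B: "\<And>x. norm (\<phi> x) \<le> norm x * B"
    using \<phi>.bounded by blast
  have lower: "- B\<^sup>2 / 2 \<le> J x" for x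
  proof -
    have "\<phi> x \<le> norm x * B"
      using B[of x] by (simp add: abs_le_iff)
    moreover have "0 \<le> (norm x - B)\<^sup>2" by simp
    ultimately show ?thesis
      by (simp add: J_def power2_norm_eq_inner[symmetric] power2_diff)
  qed
  then have bdd: "bdd_below (range J)"
    by (intro bdd_belowI[of _ "- B\<^sup>2 / 2"]) auto
  define m where "m = Inf (range J)"
  have m_le: "m \<le> J x" for x
    unfolding m_def by (rule cInf_lower[OF _ bdd]) simp
  have "\<exists>x. J x < m + 1 / real (Suc n)" for n
    using cInf_lessD[of "range J" "m + 1 / real (Suc n)"] by (auto simp: m_def)
  then obtain X where X: "\<And>n. J (X n) < m + 1 / real (Suc n)"
    by metis
  have close: "(norm (x - x'))\<^sup>2 \<le> 4 * (J x + J x' - 2 * m)" for x x'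
  proof -
    have "J x + J x' - 2 * J ((1/2) *\<^sub>R (x + x')) = (norm (x - x'))\<^sup>2 / 4"
      by (simp add: J_def power2_norm_eq_inner \<phi>.add \<phi>.scaleR inner_simps inner_commute
          algebra_simps)
    then show ?thesis
      using m_le[of "(1/2) *\<^sub>R (x + x')"] by simp
  qed
  have "Cauchy X"
  proof (rule Cauchy_if_norm_diff_sq_le)
    fix j k :: nat
    assume "j \<le> k"
    then have "1 / real (Suc k) \<le> 1 / real (Suc j)"
      by (simp add: frac_le)
    then have "J (X j) + J (X k) - 2 * m \<le> 2 * (1 / real (Suc j))"
      using add_strict_mono[OF X[of j] X[of k]] by argo
    then have "4 * (J (X j) + J (X k) - 2 * m) \<le> 8 * (1 / real (Suc j))"
      by argo
    then show "(norm (X j - X k))\<^sup>2 \<le> 8 * (1 / real (Suc j))"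
      by (rule order_trans[OF close])
  next
    show "(\<lambda>j. 8 * (1 / real (Suc j))) \<longlonglongrightarrow> 0"
      using tendsto_mult_right_zero[OF LIMSEQ_inverse_real_of_nat, of 8]
      by (simp add: inverse_eq_divide)
  qed
  then obtain u where u: "X \<longlonglongrightarrow> u"
    using Cauchy_convergent_iff convergent_def by blast
  have "(\<lambda>n. J (X n)) \<longlonglongrightarrow> J u"
    unfolding J_def by (intro tendsto_intros u \<phi>.tendsto) simp
  moreover have "(\<lambda>n. m + 1 / real (Suc n)) \<longlonglongrightarrow> m + 0"
    using LIMSEQ_inverse_real_of_nat by (intro tendsto_add) (simp_all add: inverse_eq_divide)
  ultimately have "J u \<le> m"
    using X by (intro LIMSEQ_le[of _ "J u" _ m]) (auto intro: less_imp_le)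
  then have min: "J u \<le> J x" for x
    using m_le order_trans by blast
  have "\<phi> h = h \<bullet> u" for h
  proof -
    define d q where "d = u \<bullet> h - \<phi> h" and "q = h \<bullet> h"
    have q: "q \<ge> 0" by (simp add: q_def)
    have expand: "J (u + t *\<^sub>R h) = J u + t * d + t\<^sup>2 * q / 2" for t
      by (simp add: J_def d_def q_def \<phi>.add \<phi>.scaleR inner_simps inner_commute power2_eq_square
          field_simps)
    \<comment> \<open>The minimum over \<open>t\<close> is at \<open>- d / q\<close>; adding 1 avoids the case \<open>q = 0\<close> and still makes the
      increment negative unless \<open>d = 0\<close>.\<close>
    define t where "t = - d / (q + 1)"
    have d: "d = - t * (q + 1)"
      using q by (simp add: t_def)
    have "0 \<le> t * d + t\<^sup>2 * q / 2"
      using min[of "u + t *\<^sub>R h"] expand[of t] by simp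
    also have "\<dots> = - (t\<^sup>2 * (q / 2 + 1))"
      unfolding d by (simp add: power2_eq_square algebra_simps)
    finally have "t = 0"
      using q by (simp add: mult_le_0_iff)
    then have "d = 0" by (simp add: d)
    then show ?thesis by (simp add: d_def inner_commute)
  qed
  then show ?thesis by (rule that)
qed

lemma inner_adjoint_blinfun:
  fixes A :: "'a::{real_inner,banach} \<Rightarrow>\<^sub>L 'b::real_inner"
  shows "h \<bullet> adjoint (blinfun_apply A) v = blinfun_apply A h \<bullet> v"
proof -
  have "\<exists>u. \<forall>h. blinfun_apply A h \<bullet> v = h \<bullet> u" for v
  proof -
    have "bounded_linear (\<lambda>h. blinfun_apply A h \<bullet> v)"
      by (intro bounded_linear_inner_left_comp blinfun.bounded_linear_right)
    then show ?thesis by (rule riesz_representation) blast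
  qed
  then have "\<exists>B. \<forall>h v. blinfun_apply A h \<bullet> v = h \<bullet> B v"
    by metis
  then have "\<forall>h v. blinfun_apply A h \<bullet> v = h \<bullet> adjoint (blinfun_apply A) v"
    unfolding adjoint_def by (rule someI_ex)
  then show ?thesis by simp
qed

lemma norm_adjoint_blinfun_le:
  fixes A :: "'a::{real_inner,banach} \<Rightarrow>\<^sub>L 'b::real_inner"
  shows "norm (adjoint (blinfun_apply A) v) \<le> norm A * norm v"
proof -
  define s where "s = adjoint (blinfun_apply A) v"
  have "norm s * norm s = blinfun_apply A s \<bullet> v"
    using inner_adjoint_blinfun[of s A v] by (simp add: s_def flip: power2_norm_eq_inner power2_eq_square)
  also have "\<dots> \<le> norm (blinfun_apply A s) * norm v"
    by (rule norm_cauchy_schwarz)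
  also have "\<dots> \<le> (norm A * norm s) * norm v"
    by (intro mult_right_mono norm_blinfun) simp
  finally have "norm s * norm s \<le> norm s * (norm A * norm v)"
    by (simp add: mult_ac)
  then have "norm s \<le> norm A * norm v"
    by (cases "norm s = 0") (auto dest: mult_left_le_imp_le)
  then show ?thesis by (simp add: s_def)
qed

section \<open>A Cauchy criterion for Fejer monotone sequences\<close>

text \<open>
  The expansion of \<open>\<parallel>z l - z j\<parallel>\<^sup>2\<close> consists of a difference of squared distances to \<open>p\<close>, which form a
  convergent sequence, and of twice the inner product of \<open>z l - z j\<close> with \<open>z l - p\<close>. The
  hypothesis \<open>cross\<close> bounds the latter by a sum that telescopes whenever \<open>c l\<close> is at most all the
  \<open>c m\<close> involved; therefore two arbitrary members are compared through the member between them
  with the least value of \<open>c\<close>.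
\<close>
lemma Fejer_imp_Cauchy:
  fixes z :: "nat \<Rightarrow> 'a::real_inner" and c :: "nat \<Rightarrow> real"
  assumes c: "\<And>m. c m \<ge> 0" and "K > 0" and "C \<ge> 0"
    and desc: "\<And>m. (c m)\<^sup>2 \<le> K * ((norm (z m - p))\<^sup>2 - (norm (z (Suc m) - p))\<^sup>2)"
    and cross: "\<And>m l. \<bar>(z (Suc m) - z m) \<bullet> (z l - p)\<bar> \<le> C * c m * (c m + c l)"
  shows "Cauchy z"
proof -
  define a where "a m = (norm (z m - p))\<^sup>2" for m
  have step: "a (Suc m) \<le> a m" for m
  proof -
    have "0 \<le> K * (a m - a (Suc m))"
      using desc[of m] by (simp add: a_def order_trans[OF zero_le_power2])
    then show ?thesis using \<open>K > 0\<close> by (simp add: zero_le_mult_iff)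
  qed
  then have "decseq a" by (rule decseq_SucI)
  moreover have "\<forall>m. 0 \<le> a m" by (simp add: a_def)
  ultimately obtain L where L: "a \<longlonglongrightarrow> L" "\<forall>m. L \<le> a m"
    by (rule decseq_convergent)
  define B where "B = 4 * C * K"
  have B: "B \<ge> 0" using \<open>K > 0\<close> \<open>C \<ge> 0\<close> by (simp add: B_def)
  have inner_bound: "2 * \<bar>(z k - z j) \<bullet> (z l - p)\<bar> \<le> B * (a j - a k)"
    if "j \<le> k" and least: "\<And>m. j \<le> m \<Longrightarrow> m < k \<Longrightarrow> c l \<le> c m" for j k l
  proof -
    have "(z k - z j) \<bullet> (z l - p) = (\<Sum>m=j..<k. (z (Suc m) - z m) \<bullet> (z l - p))"
      by (simp add: sum_Suc_diff'[OF \<open>j \<le> k\<close>] flip: inner_sum_left)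
    also have "\<bar>\<dots>\<bar> \<le> (\<Sum>m=j..<k. 2 * C * K * (a m - a (Suc m)))"
    proof (rule order_trans[OF sum_abs], rule sum_mono)
      fix m assume m: "m \<in> {j..<k}"
      have "\<bar>(z (Suc m) - z m) \<bullet> (z l - p)\<bar> \<le> C * c m * (c m + c l)"
        by (rule cross)
      also have "\<dots> \<le> C * c m * (c m + c m)"
        using m least[of m] c \<open>C \<ge> 0\<close> by (intro mult_left_mono) auto
      also have "\<dots> = 2 * C * (c m)\<^sup>2"
        by (simp add: power2_eq_square)
      also have "\<dots> \<le> 2 * C * (K * (a m - a (Suc m)))"
        using desc[of m] \<open>C \<ge> 0\<close> by (intro mult_left_mono) (simp_all add: a_def)
      finally show "\<bar>(z (Suc m) - z m) \<bullet> (z l - p)\<bar> \<le> 2 * C * K * (a m - a (Suc m))"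
        by (simp add: mult_ac)
    qed
    also have "\<dots> = 2 * C * K * (a j - a k)"
      using sum_Suc_diff'[OF \<open>j \<le> k\<close>, of "\<lambda>m. - a m"]
      by (simp add: sum_distrib_left[symmetric])
    finally show ?thesis by (simp add: B_def)
  qed
  show ?thesis
  proof (rule Cauchy_if_norm_diff_sq_le)
    fix j k :: nat
    assume "j \<le> k"
    then obtain l where "is_arg_min c (\<lambda>m. m \<in> {j..k}) l"
      using ex_is_arg_min_if_finite[of "{j..k}" c] by auto
    then have l: "j \<le> l" "l \<le> k" and least: "\<And>m. j \<le> m \<Longrightarrow> m \<le> k \<Longrightarrow> c l \<le> c m"
      by (auto simp: is_arg_min_linorder)
    have "(norm (z l - z j))\<^sup>2 = 2 * ((z l - z j) \<bullet> (z l - p)) + (a j - a l)"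
      by (simp add: a_def power2_norm_eq_inner inner_simps inner_commute)
    then have lj: "(norm (z l - z j))\<^sup>2 \<le> (B + 1) * (a j - a l)"
      using inner_bound[of j l l] l least abs_ge_self[of "(z l - z j) \<bullet> (z l - p)"]
      unfolding distrib_right mult_1 by fastforce
    have "(norm (z k - z l))\<^sup>2 = - 2 * ((z k - z l) \<bullet> (z l - p)) - (a l - a k)"
      by (simp add: a_def power2_norm_eq_inner inner_simps inner_commute)
    moreover have mono: "a k \<le> a l"
      using \<open>decseq a\<close> l by (simp add: decseqD)
    ultimately have kl: "(norm (z k - z l))\<^sup>2 \<le> (B + 1) * (a l - a k)"
      using inner_bound[of l k l] l least abs_ge_minus_self[of "(z k - z l) \<bullet> (z l - p)"]
      unfolding distrib_right mult_1 by fastforce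
    have "norm (z j - z k) \<le> norm (z l - z j) + norm (z k - z l)"
      using norm_triangle_ineq[of "z j - z l" "z l - z k"] by (simp add: norm_minus_commute)
    then have "(norm (z j - z k))\<^sup>2 \<le> (norm (z l - z j) + norm (z k - z l))\<^sup>2"
      by (intro power_mono) auto
    also have "\<dots> \<le> 2 * (norm (z l - z j))\<^sup>2 + 2 * (norm (z k - z l))\<^sup>2"
      using zero_le_power2[of "norm (z l - z j) - norm (z k - z l)"]
      by (simp add: power2_sum power2_diff)
    also have "\<dots> \<le> 2 * ((B + 1) * (a j - a l)) + 2 * ((B + 1) * (a l - a k))"
      using lj kl by linarith
    also have "\<dots> = 2 * (B + 1) * (a j - a k)"
      by (simp add: algebra_simps)
    also have "\<dots> \<le> 2 * (B + 1) * (a j - L)"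
      using L(2) B by (intro mult_left_mono) auto
    finally show "(norm (z j - z k))\<^sup>2 \<le> 2 * (B + 1) * (a j - L)" .
  next
    have "(\<lambda>j. 2 * (B + 1) * (a j - L)) \<longlonglongrightarrow> 2 * (B + 1) * (L - L)"
      by (intro tendsto_intros L)
    then show "(\<lambda>j. 2 * (B + 1) * (a j - L)) \<longlonglongrightarrow> 0" by simp
  qed
qed

section \<open>The iteration\<close>

locale sd_kaczmarz_setting =
  fixes N :: nat
    and F :: "nat \<Rightarrow> 'a::{real_inner,banach} \<Rightarrow> 'b::{real_inner,banach}"
    and F' :: "nat \<Rightarrow> 'a \<Rightarrow> 'a \<Rightarrow>\<^sub>L 'b"
    and y :: "nat \<Rightarrow> 'b"
    and \<Phi> :: "real \<Rightarrow> real"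
    and x0 xstar :: 'a
    and M \<rho> \<eta> \<alpha>max :: real
  assumes N: "N \<ge> 1" and M: "M > 0"
    and deriv: "\<And>i x. i < N \<Longrightarrow> x \<in> ball x0 \<rho> \<Longrightarrow>
      (F i has_derivative blinfun_apply (F' i x)) (at x)"
    and deriv_bound: "\<And>i x. i < N \<Longrightarrow> x \<in> ball x0 \<rho> \<Longrightarrow> norm (F' i x) \<le> M"
    and \<eta>: "\<eta> < 1 / 2"
    and cone: "\<And>i x x'. i < N \<Longrightarrow> x \<in> ball x0 \<rho> \<Longrightarrow> x' \<in> ball x0 \<rho> \<Longrightarrow>
      norm (F i x - F i x' - blinfun_apply (F' i x) (x - x')) \<le> \<eta> * norm (F i x - F i x')"
    and xstar: "xstar \<in> ball x0 (\<rho> / 2)" "\<And>i. i < N \<Longrightarrow> F i xstar = y i"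
    and \<Phi>_mono: "mono_on {0<..} \<Phi>"
    and \<Phi>_pos: "\<And>s. s > 0 \<Longrightarrow> \<Phi> s > 0"
    and \<Phi>_bound: "\<And>s. s > 0 \<Longrightarrow> \<Phi> s \<le> \<alpha>max"
    and \<Phi>_le: "\<And>s. s > 0 \<Longrightarrow> \<Phi> s \<le> s"
begin

definition \<alpha>min :: real where "\<alpha>min = \<Phi> (1 / M\<^sup>2)"

definition iter :: "nat \<Rightarrow> 'a" where "iter = sd_kaczmarz N F F' y \<Phi> \<alpha>min x0"

definition resid :: "nat \<Rightarrow> 'b" where "resid k = F (k mod N) (iter k) - y (k mod N)"

definition dir :: "nat \<Rightarrow> 'a"
  where "dir k = adjoint (blinfun_apply (F' (k mod N) (iter k))) (resid k)"

definition step :: "nat \<Rightarrow> real"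
  where "step k = sd_stepsize \<Phi> \<alpha>min (F' (k mod N) (iter k)) (dir k)"

definition cycle_resid :: "nat \<Rightarrow> real"
  where "cycle_resid m = (\<Sum>t<N. norm (resid (m * N + t)))"

lemma iter_0: "iter 0 = x0"
  by (simp add: iter_def)

lemma iter_Suc: "iter (Suc k) = iter k - step k *\<^sub>R dir k"
  by (simp add: iter_def step_def dir_def resid_def sd_direction_def Let_def)

lemma mod_N_less: "k mod N < N"
  using N by simp

lemma \<alpha>min_pos: "\<alpha>min > 0"
  unfolding \<alpha>min_def using M by (intro \<Phi>_pos) simp

lemma \<alpha>min_le_\<alpha>max: "\<alpha>min \<le> \<alpha>max"
  unfolding \<alpha>min_def using M by (intro \<Phi>_bound) simp

lemma half_ball_subset: "x \<in> ball x0 (\<rho> / 2) \<Longrightarrow> x \<in> ball x0 \<rho>"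
  using zero_le_dist[of x0 x] by (simp del: zero_le_dist)

text \<open>
  The two-sided comparison of a difference of values with its linearisation has constants
  \<open>1 + \<eta>\<close> and \<open>1 / (1 - \<eta>)\<close>; both are at most 2.
\<close>
lemma norm_deriv_le:
  assumes "i < N" "x \<in> ball x0 \<rho>" "x' \<in> ball x0 \<rho>"
  shows "norm (blinfun_apply (F' i x) (x - x')) \<le> 2 * norm (F i x - F i x')"
proof -
  have "norm (blinfun_apply (F' i x) (x - x'))
      \<le> norm (F i x - F i x') + norm (F i x - F i x' - blinfun_apply (F' i x) (x - x'))"
    using norm_triangle_ineq4[of "F i x - F i x'" "F i x - F i x' - blinfun_apply (F' i x) (x - x')"]
    by simp
  also have "\<dots> \<le> norm (F i x - F i x') + \<eta> * norm (F i x - F i x')"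
    using cone[OF assms] by simp
  also have "\<eta> * norm (F i x - F i x') \<le> 1 * norm (F i x - F i x')"
    using \<eta> by (intro mult_right_mono) auto
  finally show ?thesis by simp
qed

lemma norm_F_diff_le:
  assumes "i < N" "x \<in> ball x0 \<rho>" "x' \<in> ball x0 \<rho>"
  shows "norm (F i x - F i x') \<le> 2 * M * norm (x - x')"
proof -
  have "norm (F i x - F i x') \<le> norm (blinfun_apply (F' i x) (x - x'))
      + norm (F i x - F i x' - blinfun_apply (F' i x) (x - x'))"
    using norm_triangle_ineq[of "blinfun_apply (F' i x) (x - x')"
        "F i x - F i x' - blinfun_apply (F' i x) (x - x')"]
    by simp
  also have "\<dots> \<le> M * norm (x - x') + 1/2 * norm (F i x - F i x')"
  proof (rule add_mono)
    show "norm (blinfun_apply (F' i x) (x - x')) \<le> M * norm (x - x')"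
      using norm_blinfun[of "F' i x" "x - x'"] deriv_bound[OF assms(1,2)]
      by (meson mult_right_mono norm_ge_zero order_trans)
    have "\<eta> * norm (F i x - F i x') \<le> 1/2 * norm (F i x - F i x')"
      using \<eta> by (intro mult_right_mono) auto
    then show "norm (F i x - F i x' - blinfun_apply (F' i x) (x - x')) \<le> 1/2 * norm (F i x - F i x')"
      using cone[OF assms] by linarith
  qed
  finally show ?thesis by simp
qed

subsection \<open>A single step\<close>

text \<open>
  For \<open>s = A\<^sup>* r\<close> the identity \<open>\<parallel>s\<parallel>\<^sup>2 = \<langle>A s, r\<rangle>\<close> gives \<open>\<parallel>s\<parallel>\<^sup>2 \<le> \<parallel>A s\<parallel> \<parallel>r\<parallel>\<close>. Hence
  \<open>A s\<close> vanishes only if \<open>s\<close> does, and the quotient \<open>\<parallel>s\<parallel>\<^sup>2 / \<parallel>A s\<parallel>\<^sup>2\<close> times \<open>\<parallel>s\<parallel>\<^sup>2\<close> is at most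
  \<open>\<parallel>r\<parallel>\<^sup>2\<close>. The bound \<open>\<parallel>A\<parallel> \<le> M\<close> puts that quotient above \<open>1 / M\<^sup>2\<close>.
\<close>
lemma step_bounds:
  assumes "iter k \<in> ball x0 \<rho>"
  shows "\<alpha>min \<le> step k" "step k \<le> \<alpha>max" "step k * (norm (dir k))\<^sup>2 \<le> (norm (resid k))\<^sup>2"
proof -
  define A where "A = F' (k mod N) (iter k)"
  have A: "norm A \<le> M"
    unfolding A_def using mod_N_less assms by (rule deriv_bound)
  have "\<alpha>min \<le> step k \<and> step k \<le> \<alpha>max \<and> step k * (norm (dir k))\<^sup>2 \<le> (norm (resid k))\<^sup>2"
  proof (cases "dir k = 0")
    case True
    then show ?thesis using \<alpha>min_le_\<alpha>max by (simp add: step_def sd_stepsize_def)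
  next
    case False
    define n v where "n = norm (dir k)" and "v = norm (blinfun_apply A (dir k))"
    have n: "n > 0" using False by (simp add: n_def)
    have "n\<^sup>2 = blinfun_apply A (dir k) \<bullet> resid k"
      unfolding n_def power2_norm_eq_inner
      by (subst (2) dir_def) (simp add: inner_adjoint_blinfun A_def)
    also have "\<dots> \<le> v * norm (resid k)"
      unfolding v_def by (rule norm_cauchy_schwarz)
    finally have nv: "n\<^sup>2 \<le> v * norm (resid k)" .
    then have v: "v > 0"
      using n by (cases "v = 0") (auto simp: v_def)
    have vM: "v \<le> M * n"
      unfolding v_def n_def using norm_blinfun[of A "dir k"] A
      by (meson mult_right_mono norm_ge_zero order_trans)
    have step: "step k = \<Phi> (n\<^sup>2 / v\<^sup>2)"
      using False by (simp add: step_def sd_stepsize_def n_def v_def A_def)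
    have q: "n\<^sup>2 / v\<^sup>2 > 0" using n v by simp
    have "v\<^sup>2 \<le> (M * n)\<^sup>2"
      using vM v by (intro power_mono) auto
    then have "1 / M\<^sup>2 \<le> n\<^sup>2 / v\<^sup>2"
      using v M by (simp add: field_simps power_mult_distrib)
    then have "\<alpha>min \<le> step k"
      unfolding step \<alpha>min_def using q M by (intro mono_onD[OF \<Phi>_mono]) auto
    moreover have "step k * n\<^sup>2 \<le> (norm (resid k))\<^sup>2"
    proof -
      have "step k * n\<^sup>2 \<le> (n\<^sup>2 / v\<^sup>2) * n\<^sup>2"
        unfolding step by (intro mult_right_mono \<Phi>_le q) simp
      also have "\<dots> = (n\<^sup>2 / v)\<^sup>2"
        by (simp add: power2_eq_square)
      also have "\<dots> \<le> (norm (resid k))\<^sup>2"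
        using nv v by (intro power_mono) (auto simp: field_simps)
      finally show ?thesis .
    qed
    ultimately show ?thesis
      using \<Phi>_bound[OF q] by (simp add: step n_def)
  qed
  then show "\<alpha>min \<le> step k" "step k \<le> \<alpha>max" "step k * (norm (dir k))\<^sup>2 \<le> (norm (resid k))\<^sup>2"
    by auto
qed

text \<open>
  With \<open>e\<close> the error, \<open>\<langle>e, s\<rangle> = \<langle>A e, r\<rangle>\<close>, and by the cone condition \<open>A e\<close> differs from \<open>r\<close> by at
  most \<open>\<eta> \<parallel>r\<parallel>\<close>. So the linear term of the expansion gains \<open>2 (1 - \<eta>) \<alpha> \<parallel>r\<parallel>\<^sup>2\<close>, of which the
  quadratic term \<open>\<alpha>\<^sup>2 \<parallel>s\<parallel>\<^sup>2\<close> gives back at most \<open>\<alpha> \<parallel>r\<parallel>\<^sup>2\<close>.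
\<close>
lemma step_descent:
  assumes k: "iter k \<in> ball x0 \<rho>" and z: "z \<in> ball x0 \<rho>" "\<And>i. i < N \<Longrightarrow> F i z = y i"
  shows "\<alpha>min * (1 - 2 * \<eta>) * (norm (resid k))\<^sup>2
    \<le> (norm (iter k - z))\<^sup>2 - (norm (iter (Suc k) - z))\<^sup>2"
proof -
  define e r \<alpha> where "e = iter k - z" and "r = resid k" and "\<alpha> = step k"
  define Ae where "Ae = blinfun_apply (F' (k mod N) (iter k)) e"
  note bounds = step_bounds[OF k, folded r_def \<alpha>_def]
  have \<alpha>: "\<alpha> > 0" using bounds(1) \<alpha>min_pos by linarith
  have e_dir: "e \<bullet> dir k = Ae \<bullet> r"
    by (simp add: dir_def inner_adjoint_blinfun Ae_def r_def)
  have "(r - Ae) \<bullet> r \<le> norm (r - Ae) * norm r"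
    by (rule norm_cauchy_schwarz)
  also have "norm (r - Ae) \<le> \<eta> * norm r"
    using cone[OF mod_N_less k z(1), of k] z(2)[OF mod_N_less]
    by (simp add: r_def resid_def Ae_def e_def)
  finally have "(r - Ae) \<bullet> r \<le> \<eta> * norm r * norm r"
    by (simp add: mult_right_mono)
  then have descent: "(1 - \<eta>) * (norm r)\<^sup>2 \<le> e \<bullet> dir k"
    by (simp add: e_dir inner_diff_left power2_norm_eq_inner[symmetric] algebra_simps
        power2_eq_square)
  have expand: "(norm e)\<^sup>2 - (norm (iter (Suc k) - z))\<^sup>2
      = \<alpha> * (2 * (e \<bullet> dir k) - \<alpha> * (norm (dir k))\<^sup>2)"
    by (simp add: iter_Suc e_def \<alpha>_def power2_norm_eq_inner inner_simps inner_commute algebra_simps)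
  have "\<alpha>min * (1 - 2 * \<eta>) * (norm r)\<^sup>2 = \<alpha>min * ((1 - 2 * \<eta>) * (norm r)\<^sup>2)"
    by simp
  also have "\<dots> \<le> \<alpha> * ((1 - 2 * \<eta>) * (norm r)\<^sup>2)"
    using bounds(1) \<eta> by (intro mult_right_mono) auto
  also have "\<dots> \<le> \<alpha> * (2 * (e \<bullet> dir k) - \<alpha> * (norm (dir k))\<^sup>2)"
    using descent bounds(3) \<alpha> by (intro mult_left_mono) (auto simp: algebra_simps)
  finally show ?thesis using expand by (simp add: e_def r_def)
qed

lemma dist_iter_decreasing:
  assumes "iter k \<in> ball x0 \<rho>" "z \<in> ball x0 \<rho>" "\<And>i. i < N \<Longrightarrow> F i z = y i"
  shows "norm (iter (Suc k) - z) \<le> norm (iter k - z)"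
proof -
  have "0 \<le> \<alpha>min * (1 - 2 * \<eta>) * (norm (resid k))\<^sup>2"
    using \<alpha>min_pos \<eta> by simp
  also note step_descent[OF assms]
  finally show ?thesis
    by - (rule power2_le_imp_le, simp_all)
qed

lemma cball_xstar_subset: "cball xstar (norm (x0 - xstar)) \<subseteq> ball x0 \<rho>"
proof
  fix x assume "x \<in> cball xstar (norm (x0 - xstar))"
  then have "dist xstar x \<le> dist x0 xstar" by (simp add: dist_norm)
  then show "x \<in> ball x0 \<rho>"
    using xstar(1) dist_triangle[of x0 x xstar] by simp
qed

text \<open>
  The closed ball around \<open>xstar\<close> is used, rather than the given open ball, since it also
  contains the limit of the iterates.
\<close>
lemma iter_in_cball: "iter k \<in> cball xstar (norm (x0 - xstar))"
proof (induction k)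
  case 0
  show ?case by (simp add: iter_0 dist_norm norm_minus_commute)
next
  case (Suc k)
  have "norm (iter (Suc k) - xstar) \<le> norm (iter k - xstar)"
    using Suc cball_xstar_subset xstar half_ball_subset by (intro dist_iter_decreasing) auto
  then show ?case using Suc by (simp add: dist_norm norm_minus_commute)
qed

lemma iter_in_ball: "iter k \<in> ball x0 \<rho>"
  by (rule subsetD[OF cball_xstar_subset iter_in_cball])

lemma norm_dir_le: "norm (dir k) \<le> M * norm (resid k)"
proof -
  have "norm (dir k) \<le> norm (F' (k mod N) (iter k)) * norm (resid k)"
    unfolding dir_def by (rule norm_adjoint_blinfun_le[of "F' (k mod N) (iter k)" "resid k"])
  also have "\<dots> \<le> M * norm (resid k)"
    by (intro mult_right_mono deriv_bound mod_N_less iter_in_ball) simp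
  finally show ?thesis .
qed

lemma norm_step_le: "norm (iter (Suc k) - iter k) \<le> \<alpha>max * M * norm (resid k)"
proof -
  have "norm (iter (Suc k) - iter k) = step k * norm (dir k)"
    using step_bounds(1)[OF iter_in_ball, of k] \<alpha>min_pos by (simp add: iter_Suc)
  also have "\<dots> \<le> \<alpha>max * (M * norm (resid k))"
    using step_bounds(2)[OF iter_in_ball, of k] \<alpha>min_le_\<alpha>max \<alpha>min_pos
    by (intro mult_mono norm_dir_le) simp_all
  finally show ?thesis by simp
qed

subsection \<open>A full cycle\<close>

lemma cycle_resid_nonneg: "cycle_resid m \<ge> 0"
  by (simp add: cycle_resid_def sum_nonneg)

lemma resid_le_cycle_resid: "t < N \<Longrightarrow> norm (resid (m * N + t)) \<le> cycle_resid m"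
  unfolding cycle_resid_def by (rule member_le_sum) auto

lemma cycle_increment: "iter (Suc m * N) - iter (m * N) = (\<Sum>t<N. iter (Suc (m * N + t)) - iter (m * N + t))"
  using sum_lessThan_telescope[of "\<lambda>t. iter (m * N + t)" N] by (simp add: add.commute)

lemma norm_within_cycle_le:
  assumes "t < N"
  shows "norm (iter (m * N + t) - iter (m * N)) \<le> \<alpha>max * M * cycle_resid m"
proof -
  have \<alpha>max: "\<alpha>max \<ge> 0" using \<alpha>min_le_\<alpha>max \<alpha>min_pos by linarith
  have "norm (iter (m * N + t) - iter (m * N))
      = norm (\<Sum>i<t. iter (Suc (m * N + i)) - iter (m * N + i))"
    using sum_lessThan_telescope[of "\<lambda>t. iter (m * N + t)" t] by simp
  also have "\<dots> \<le> (\<Sum>i<t. \<alpha>max * M * norm (resid (m * N + i)))"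
    by (intro sum_norm_le norm_step_le)
  also have "\<dots> \<le> (\<Sum>i<N. \<alpha>max * M * norm (resid (m * N + i)))"
    using assms \<alpha>max M
    by (intro sum_mono2) auto
  also have "\<dots> = \<alpha>max * M * cycle_resid m"
    unfolding cycle_resid_def by (rule sum_distrib_left[symmetric])
  finally show ?thesis .
qed

text \<open>
  The method evaluates the \<open>i\<close>-th equation only \<open>i\<close> steps after the start of the cycle; the iterate
  has moved by at most a multiple of \<open>cycle_resid m\<close> until then.
\<close>
lemma resid_at_cycle_start_le:
  assumes i: "i < N"
  shows "norm (F i (iter (m * N)) - y i) \<le> (1 + 2 * M * (\<alpha>max * M)) * cycle_resid m"
proof -
  have "norm (F i (iter (m * N)) - F i (iter (m * N + i)))
      \<le> 2 * M * norm (iter (m * N) - iter (m * N + i))"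
    using i by (intro norm_F_diff_le iter_in_ball)
  also have "\<dots> \<le> 2 * M * (\<alpha>max * M * cycle_resid m)"
    using norm_within_cycle_le[OF i, of m] M
    by (intro mult_left_mono) (auto simp: norm_minus_commute)
  finally have 1: "norm (F i (iter (m * N)) - F i (iter (m * N + i)))
      \<le> 2 * M * (\<alpha>max * M * cycle_resid m)" .
  have 2: "norm (F i (iter (m * N + i)) - y i) \<le> cycle_resid m"
    using resid_le_cycle_resid[OF i, of m] i by (simp add: resid_def)
  have "norm (F i (iter (m * N)) - y i)
      \<le> norm (F i (iter (m * N)) - F i (iter (m * N + i))) + norm (F i (iter (m * N + i)) - y i)"
    using norm_triangle_ineq[of "F i (iter (m * N)) - F i (iter (m * N + i))"
        "F i (iter (m * N + i)) - y i"] by simp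
  with 1 2 show ?thesis by (simp add: algebra_simps)
qed

lemma cycle_descent:
  "(cycle_resid m)\<^sup>2 \<le> real N / (\<alpha>min * (1 - 2 * \<eta>)) *
    ((norm (iter (m * N) - xstar))\<^sup>2 - (norm (iter (Suc m * N) - xstar))\<^sup>2)"
proof -
  define \<kappa> where "\<kappa> = \<alpha>min * (1 - 2 * \<eta>)"
  have \<kappa>: "\<kappa> > 0" using \<alpha>min_pos \<eta> by (simp add: \<kappa>_def)
  define b where "b t = (norm (iter (m * N + t) - xstar))\<^sup>2" for t
  have "\<kappa> * (norm (resid (m * N + t)))\<^sup>2 \<le> b t - b (Suc t)" for t
    using step_descent[OF iter_in_ball half_ball_subset[OF xstar(1)] xstar(2), of "m * N + t"]
    by (simp add: \<kappa>_def b_def)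
  then have "(\<Sum>t<N. \<kappa> * (norm (resid (m * N + t)))\<^sup>2) \<le> (\<Sum>t<N. b t - b (Suc t))"
    by (intro sum_mono) auto
  then have sum: "\<kappa> * (\<Sum>t<N. (norm (resid (m * N + t)))\<^sup>2) \<le> b 0 - b N"
    by (simp add: sum_lessThan_telescope' sum_distrib_left)
  have "\<kappa> * (cycle_resid m)\<^sup>2 \<le> \<kappa> * (real N * (\<Sum>t<N. (norm (resid (m * N + t)))\<^sup>2))"
    using sum_squared_le_sum_of_squares[of "\<lambda>t. norm (resid (m * N + t))" "{..<N}"] \<kappa>
    by (intro mult_left_mono) (auto simp: cycle_resid_def mult.commute)
  also have "\<dots> \<le> real N * (b 0 - b N)"
    using mult_left_mono[OF sum, of "real N"] by (simp add: mult_ac)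
  finally have "(cycle_resid m)\<^sup>2 \<le> real N / \<kappa> * (b 0 - b N)"
    using \<kappa> by (simp add: field_simps)
  then show ?thesis by (simp add: \<kappa>_def b_def add.commute)
qed

text \<open>
  In each step the adjoint moves the derivative \<open>A\<close> at the current iterate \<open>x\<close> onto \<open>z - xstar\<close>,
  where \<open>z\<close> starts cycle \<open>l\<close>. Writing \<open>z - xstar = (x - xstar) - (x - z)\<close> makes \<open>x\<close> the base
  point of both differences, so the cone condition bounds \<open>A (z - xstar)\<close> by the residuals at \<open>x\<close>
  and at \<open>z\<close>.
\<close>
lemma cycle_cross:
  "\<bar>(iter (Suc m * N) - iter (m * N)) \<bullet> (iter (l * N) - xstar)\<bar>
    \<le> \<alpha>max * (4 + 2 * (1 + 2 * M * (\<alpha>max * M))) * cycle_resid m * (cycle_resid m + cycle_resid l)"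
proof -
  define C where "C = 1 + 2 * M * (\<alpha>max * M)"
  have \<alpha>max: "\<alpha>max > 0" using \<alpha>min_le_\<alpha>max \<alpha>min_pos by linarith
  have C: "C \<ge> 0" using \<alpha>max M by (simp add: C_def)
  define z where "z = iter (l * N)"
  have xs: "xstar \<in> ball x0 \<rho>" using xstar(1) half_ball_subset by blast
  have summand: "\<bar>(iter (Suc (m * N + t)) - iter (m * N + t)) \<bullet> (z - xstar)\<bar>
      \<le> norm (resid (m * N + t)) * (\<alpha>max * (4 + 2 * C) * (cycle_resid m + cycle_resid l))"
    if t: "t < N" for t
  proof -
    define k x A where "k = m * N + t" and "x = iter k" and "A = F' t x"
    have kt: "k mod N = t" using t by (simp add: k_def)
    have x: "x \<in> ball x0 \<rho>" and z: "z \<in> ball x0 \<rho>"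
      unfolding x_def z_def by (rule iter_in_ball)+
    have r: "resid k = F t x - y t" by (simp add: resid_def kt x_def)
    have rm: "norm (resid k) \<le> cycle_resid m"
      unfolding k_def by (rule resid_le_cycle_resid[OF t])
    have zl: "norm (F t z - y t) \<le> C * cycle_resid l"
      unfolding C_def z_def by (rule resid_at_cycle_start_le[OF t])
    have "norm (F t x - F t z) \<le> norm (resid k) + norm (F t z - y t)"
      unfolding r using norm_triangle_ineq4[of "F t x - y t" "F t z - y t"] by simp
    then have "norm (blinfun_apply A (x - z)) \<le> 2 * (norm (resid k) + norm (F t z - y t))"
      unfolding A_def by (intro order_trans[OF norm_deriv_le[OF t x z]]) simp
    moreover have "norm (blinfun_apply A (x - xstar)) \<le> 2 * norm (resid k)"
      unfolding A_def using norm_deriv_le[OF t x xs] xstar(2)[OF t] by (simp add: r)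
    moreover have "norm (blinfun_apply A (z - xstar))
        \<le> norm (blinfun_apply A (x - xstar)) + norm (blinfun_apply A (x - z))"
      using norm_triangle_ineq4[of "blinfun_apply A (x - xstar)" "blinfun_apply A (x - z)"]
      by (simp add: blinfun.diff_right)
    ultimately have "norm (blinfun_apply A (z - xstar))
        \<le> 4 * cycle_resid m + 2 * (C * cycle_resid l)"
      using rm zl by argo
    also have "\<dots> \<le> (4 + 2 * C) * (cycle_resid m + cycle_resid l)"
      using C cycle_resid_nonneg[of m] cycle_resid_nonneg[of l] by (simp add: algebra_simps)
    finally have Az: "norm (blinfun_apply A (z - xstar))
        \<le> (4 + 2 * C) * (cycle_resid m + cycle_resid l)" .
    have "(iter (Suc k) - iter k) \<bullet> (z - xstar) = - step k * (blinfun_apply A (z - xstar) \<bullet> resid k)"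
      by (simp add: iter_Suc dir_def kt A_def x_def inner_adjoint_blinfun
          inner_commute[of "adjoint _ _"])
    then have "\<bar>(iter (Suc k) - iter k) \<bullet> (z - xstar)\<bar>
        = step k * \<bar>blinfun_apply A (z - xstar) \<bullet> resid k\<bar>"
      using step_bounds(1)[OF iter_in_ball, of k] \<alpha>min_pos by (simp add: abs_mult)
    also have "\<dots> \<le> \<alpha>max * (norm (blinfun_apply A (z - xstar)) * norm (resid k))"
      using step_bounds(2)[OF iter_in_ball, of k] \<alpha>max
      by (intro mult_mono Cauchy_Schwarz_ineq2) simp_all
    also have "\<dots> \<le> \<alpha>max * ((4 + 2 * C) * (cycle_resid m + cycle_resid l) * norm (resid k))"
      using Az \<alpha>max by (intro mult_left_mono mult_right_mono) auto
    finally show ?thesis by (simp add: k_def mult_ac)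
  qed
  have "\<bar>(iter (Suc m * N) - iter (m * N)) \<bullet> (z - xstar)\<bar>
      \<le> (\<Sum>t<N. \<bar>(iter (Suc (m * N + t)) - iter (m * N + t)) \<bullet> (z - xstar)\<bar>)"
    unfolding cycle_increment inner_sum_left by (rule sum_abs)
  also have "\<dots> \<le> (\<Sum>t<N. norm (resid (m * N + t))
      * (\<alpha>max * (4 + 2 * C) * (cycle_resid m + cycle_resid l)))"
    using summand by (intro sum_mono) auto
  also have "\<dots> = cycle_resid m * (\<alpha>max * (4 + 2 * C) * (cycle_resid m + cycle_resid l))"
    by (subst sum_distrib_right[symmetric]) (simp add: cycle_resid_def)
  also have "\<dots> = \<alpha>max * (4 + 2 * C) * cycle_resid m * (cycle_resid m + cycle_resid l)"
    by (simp add: mult_ac)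
  finally show ?thesis by (simp add: z_def C_def)
qed

subsection \<open>Convergence\<close>

lemma Cauchy_cycle_starts: "Cauchy (\<lambda>m. iter (m * N))"
proof (rule Fejer_imp_Cauchy[where p = xstar and c = cycle_resid])
  show "real N / (\<alpha>min * (1 - 2 * \<eta>)) > 0"
    using N \<alpha>min_pos \<eta> by simp
  show "0 \<le> \<alpha>max * (4 + 2 * (1 + 2 * M * (\<alpha>max * M)))"
    using \<alpha>min_le_\<alpha>max \<alpha>min_pos M by simp
qed (rule cycle_resid_nonneg cycle_descent cycle_cross)+

lemma iter_converges:
  obtains x where "iter \<longlonglongrightarrow> x" "x \<in> ball x0 \<rho>" "\<And>i. i < N \<Longrightarrow> F i x = y i"
proof -
  obtain x where x: "(\<lambda>m. iter (m * N)) \<longlonglongrightarrow> x"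
    using Cauchy_cycle_starts Cauchy_convergent_iff convergent_def by blast
  have "x \<in> cball xstar (norm (x0 - xstar))"
    by (rule Lim_in_closed_set[OF closed_cball _ _ x]) (simp_all add: iter_in_cball[simplified])
  then have xb: "x \<in> ball x0 \<rho>"
    using cball_xstar_subset by blast
  have sq: "(\<lambda>m. (cycle_resid m)\<^sup>2) \<longlonglongrightarrow> 0"
  proof (rule tendsto_sandwich[OF _ _ tendsto_const])
    show "\<forall>\<^sub>F m in sequentially. (cycle_resid m)\<^sup>2 \<le> real N / (\<alpha>min * (1 - 2 * \<eta>)) *
      ((norm (iter (m * N) - xstar))\<^sup>2 - (norm (iter (Suc m * N) - xstar))\<^sup>2)"
      by (intro always_eventually allI cycle_descent)
    have "(\<lambda>m. real N / (\<alpha>min * (1 - 2 * \<eta>)) *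
        ((norm (iter (m * N) - xstar))\<^sup>2 - (norm (iter (Suc m * N) - xstar))\<^sup>2))
      \<longlonglongrightarrow> real N / (\<alpha>min * (1 - 2 * \<eta>)) * ((norm (x - xstar))\<^sup>2 - (norm (x - xstar))\<^sup>2)"
      by (intro tendsto_intros x LIMSEQ_Suc[OF x])
    then show "(\<lambda>m. real N / (\<alpha>min * (1 - 2 * \<eta>)) *
        ((norm (iter (m * N) - xstar))\<^sup>2 - (norm (iter (Suc m * N) - xstar))\<^sup>2)) \<longlonglongrightarrow> 0"
      by simp
  qed simp
  then have c0: "cycle_resid \<longlonglongrightarrow> 0"
    using tendsto_real_sqrt[OF sq] cycle_resid_nonneg by simp
  have sol: "F i x = y i" if i: "i < N" for i
  proof -
    have "(\<lambda>m. F i (iter (m * N))) \<longlonglongrightarrow> F i x"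
      using has_derivative_continuous[OF deriv[OF i xb]] x by (rule isCont_tendsto_compose)
    moreover have "(\<lambda>m. F i (iter (m * N))) \<longlonglongrightarrow> y i"
    proof (rule LIM_zero_cancel, rule Lim_null_comparison)
      show "\<forall>\<^sub>F m in sequentially. norm (F i (iter (m * N)) - y i)
          \<le> (1 + 2 * M * (\<alpha>max * M)) * cycle_resid m"
        by (intro always_eventually allI resid_at_cycle_start_le i)
      show "(\<lambda>m. (1 + 2 * M * (\<alpha>max * M)) * cycle_resid m) \<longlonglongrightarrow> 0"
        by (rule tendsto_mult_right_zero[OF c0])
    qed
    ultimately show ?thesis by (rule LIMSEQ_unique)
  qed
  \<comment> \<open>Now that \<open>x\<close> is known to be a solution, the distance to it decreases along all iterates, so
    the subsequence of cycle starts carries the whole sequence with it.\<close>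
  have dec: "decseq (\<lambda>k. norm (iter k - x))"
    using dist_iter_decreasing[OF iter_in_ball xb sol] by (intro decseq_SucI)
  have "iter \<longlonglongrightarrow> x"
  proof (rule LIMSEQ_I)
    fix e :: real assume "e > 0"
    then obtain m where m: "norm (iter (m * N) - x) < e"
      using LIMSEQ_D[OF x] by blast
    have "norm (iter k - x) < e" if "k \<ge> m * N" for k
      using decseqD[OF dec that] m by linarith
    then show "\<exists>k0. \<forall>k\<ge>k0. norm (iter k - x) < e" by blast
  qed
  then show ?thesis using xb sol by (rule that)
qed

lemma iter_orthogonal_kernel:
  assumes "\<And>x. x \<in> ball x0 \<rho> \<Longrightarrow> h \<in> joint_kernel N F' x"
  shows "(iter k - x0) \<bullet> h = 0"
proof (induction k)
  case 0
  show ?case by (simp add: iter_0)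
next
  case (Suc k)
  have "blinfun_apply (F' (k mod N) (iter k)) h = 0"
    using assms[OF iter_in_ball[of k]] mod_N_less[of k] by (simp add: joint_kernel_def)
  then have "dir k \<bullet> h = 0"
    by (simp add: dir_def inner_adjoint_blinfun inner_commute[of "adjoint _ _"])
  with Suc show ?case by (simp add: iter_Suc inner_diff_left)
qed

text \<open>
  The limit \<open>x\<close> is only known to lie in the ball of radius \<open>\<rho>\<close>, while \<open>z\<close> is minimal among the
  solutions in the half ball. Orthogonality of \<open>x - x0\<close> to \<open>z - x\<close> gives
  \<open>\<parallel>z - x0\<parallel>\<^sup>2 = \<parallel>x - x0\<parallel>\<^sup>2 + \<parallel>z - x\<parallel>\<^sup>2\<close>, which first places \<open>x\<close> in the half ball and then, by
  minimality, forces \<open>z = x\<close>.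
\<close>
lemma limit_eq_min_norm_solution:
  assumes lim: "iter \<longlonglongrightarrow> x" and x: "x \<in> ball x0 \<rho>" "\<And>i. i < N \<Longrightarrow> F i x = y i"
    and z: "z \<in> ball x0 (\<rho> / 2)" "\<And>i. i < N \<Longrightarrow> F i z = y i"
    and min: "\<And>w. w \<in> ball x0 (\<rho> / 2) \<Longrightarrow> (\<And>i. i < N \<Longrightarrow> F i w = y i) \<Longrightarrow>
      norm (z - x0) \<le> norm (w - x0)"
    and ker: "\<And>w. w \<in> ball x0 \<rho> \<Longrightarrow> joint_kernel N F' z \<subseteq> joint_kernel N F' w"
  shows "x = z"
proof -
  have zb: "z \<in> ball x0 \<rho>" using z(1) by (rule half_ball_subset)
  have "blinfun_apply (F' i z) (z - x) = 0" if "i < N" for i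
    using norm_deriv_le[OF that zb x(1)] x(2)[OF that] z(2)[OF that] by simp
  then have "z - x \<in> joint_kernel N F' z" by (simp add: joint_kernel_def)
  then have orth: "(iter k - x0) \<bullet> (z - x) = 0" for k
    using ker by (intro iter_orthogonal_kernel) blast
  have "(\<lambda>k. (iter k - x0) \<bullet> (z - x)) \<longlonglongrightarrow> (x - x0) \<bullet> (z - x)"
    by (intro tendsto_intros lim)
  then have "(x - x0) \<bullet> (z - x) = 0"
    using orth by (simp add: LIMSEQ_const_iff)
  then have pyth: "(norm (z - x0))\<^sup>2 = (norm (x - x0))\<^sup>2 + (norm (z - x))\<^sup>2"
    by (simp add: power2_norm_eq_inner inner_simps inner_commute)
  then have "norm (x - x0) \<le> norm (z - x0)"
    by - (rule power2_le_imp_le, simp_all)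
  then have "x \<in> ball x0 (\<rho> / 2)"
    using z(1) by (simp add: dist_norm norm_minus_commute)
  then have "norm (z - x0) \<le> norm (x - x0)"
    using x(2) by (intro min) auto
  then have "(norm (z - x0))\<^sup>2 \<le> (norm (x - x0))\<^sup>2"
    by (intro power_mono) auto
  with pyth show ?thesis by simp
qed

end

section \<open>The convergence theorem\<close>

theorem theorem3p3:
  fixes N :: nat
    and D :: "nat \<Rightarrow> 'a::{real_inner,banach} set"
    and F :: "nat \<Rightarrow> 'a \<Rightarrow> 'b::{real_inner,banach}"
    and F' :: "nat \<Rightarrow> 'a \<Rightarrow> 'a \<Rightarrow>\<^sub>L 'b"
    and y :: "nat \<Rightarrow> 'b"
    and \<Phi> :: "real \<Rightarrow> real"
    and x0 xstar :: 'a
    and M \<rho> \<eta> \<alpha>max :: real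
  assumes "N \<ge> 1" and "M > 0" and "\<rho> > 0"
    and domain: "ball x0 \<rho> \<subseteq> (\<Inter>i<N. D i)"
    and deriv: "\<And>i x. i < N \<Longrightarrow> x \<in> ball x0 \<rho> \<Longrightarrow>
      (F i has_derivative blinfun_apply (F' i x)) (at x)"
    and deriv_cont: "\<And>i. i < N \<Longrightarrow> continuous_on (ball x0 \<rho>) (F' i)"
    and deriv_bound: "\<And>i x. i < N \<Longrightarrow> x \<in> ball x0 \<rho> \<Longrightarrow> norm (F' i x) \<le> M"
    and "\<eta> < 1 / 2"
    and cone: "\<And>i x x'. i < N \<Longrightarrow> x \<in> ball x0 \<rho> \<Longrightarrow> x' \<in> ball x0 \<rho> \<Longrightarrow>
      norm (F i x - F i x' - blinfun_apply (F' i x) (x - x')) \<le> \<eta> * norm (F i x - F i x')"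
    and xstar: "xstar \<in> ball x0 (\<rho> / 2)" "\<And>i. i < N \<Longrightarrow> F i xstar = y i"
    and \<Phi>_cont: "continuous_on {0<..} \<Phi>"
    and \<Phi>_mono: "mono_on {0<..} \<Phi>"
    and \<Phi>_pos: "\<And>s. s > 0 \<Longrightarrow> \<Phi> s > 0"
    and \<Phi>_bound: "\<And>s. s > 0 \<Longrightarrow> \<Phi> s \<le> \<alpha>max"
    and \<Phi>_le: "\<And>s. s > 0 \<Longrightarrow> \<Phi> s \<le> s"
  shows "(\<exists>x \<in> solutions N D F y.
            sd_kaczmarz N F F' y \<Phi> (\<Phi> (1 / M\<^sup>2)) x0 \<longlonglongrightarrow> x) \<and>
         (\<forall>xdag. is_min_norm_solution N D F y x0 (\<rho> / 2) xdag \<longrightarrow>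
            (\<forall>x \<in> ball x0 \<rho>. joint_kernel N F' xdag \<subseteq> joint_kernel N F' x) \<longrightarrow>
            sd_kaczmarz N F F' y \<Phi> (\<Phi> (1 / M\<^sup>2)) x0 \<longlonglongrightarrow> xdag)"
proof -
  interpret sd_kaczmarz_setting N F F' y \<Phi> x0 xstar M \<rho> \<eta> \<alpha>max
    by unfold_locales (fact assms)+
  have seq: "sd_kaczmarz N F F' y \<Phi> (\<Phi> (1 / M\<^sup>2)) x0 = iter"
    by (simp add: iter_def \<alpha>min_def)
  obtain x where lim: "iter \<longlonglongrightarrow> x" and x: "x \<in> ball x0 \<rho>" "\<And>i. i < N \<Longrightarrow> F i x = y i"
    using iter_converges by blast
  have solutions_iff: "w \<in> solutions N D F y \<longleftrightarrow> (\<forall>i<N. F i w = y i)" if "w \<in> ball x0 \<rho>" for w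
    using that domain by (auto simp: solutions_def)
  have "x = xdag"
    if xdag: "is_min_norm_solution N D F y x0 (\<rho> / 2) xdag"
      and ker: "\<forall>x \<in> ball x0 \<rho>. joint_kernel N F' xdag \<subseteq> joint_kernel N F' x" for xdag
  proof (rule limit_eq_min_norm_solution[OF lim x])
    show ball: "xdag \<in> ball x0 (\<rho> / 2)" and "\<And>i. i < N \<Longrightarrow> F i xdag = y i"
      using xdag by (auto simp: is_min_norm_solution_def solutions_def)
    show "norm (xdag - x0) \<le> norm (w - x0)"
      if "w \<in> ball x0 (\<rho> / 2)" "\<And>i. i < N \<Longrightarrow> F i w = y i" for w
    proof -
      have "w \<in> ball x0 (\<rho> / 2) \<inter> solutions N D F y"
        using that solutions_iff[OF half_ball_subset] by blast
      then have "(INF x \<in> ball x0 (\<rho> / 2) \<inter> solutions N D F y. norm (x - x0)) \<le> norm (w - x0)"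
        by (intro cINF_lower bdd_belowI[of _ 0]) auto
      then show ?thesis using xdag by (simp add: is_min_norm_solution_def)
    qed
    show "joint_kernel N F' xdag \<subseteq> joint_kernel N F' w" if "w \<in> ball x0 \<rho>" for w
      using ker that by blast
  qed
  moreover have "x \<in> solutions N D F y"
    using x solutions_iff by blast
  ultimately show ?thesis
    unfolding seq using lim by blast
qed

end
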